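(* Let $\Sigma$ be a structurally well-posed $n\times n$ signature matrix. Let $(c,d)$ be a normalised offset vector of $\Sigma$ with Jacobian sparsity pattern $S_0=S_0(c,d)$ and lead-time vector $K=\psi(c)$. Then an ordering of the irreducible (fine) blocks puts $S_0$ into block-triangular form if and only if it respects the order of the acyclic graph $\mathrm{FBG}(K)$.
   Context: A signature matrix is an $n\times n$ matrix $\Sigma=(\sigma_{ij})$ with entries in $\mathbb{Z}_{\ge0}\cup\{-\infty\}$. A transversal is a set $T$ of $n$ positions $(i,j)$ with exactly one in each row and each column; its value is $\sum_{(i,j)\in T}\sigma_{ij}$. $\Sigma$ is structurally well-posed if it has a transversal on which all $\sigma_{ij}$ are finite. A highest-value transversal (HVT) is a transversal of maximal value. The essential sparsity pattern $S_{\mathrm{ess}}$ is the union of all HVTs of $\Sigma$. The sparsity pattern of $\Sigma$ is $S=\{(i,j):\sigma_{ij}>-\infty\}$. A valid offset vector of $\Sigma$ is a pair $(c,d)$ of integer $n$-vectors with $c_i\ge0$ for all $i$, $d_j-c_i\ge\sigma_{ij}$ for all $i,j$, and equality on some HVT (equivalently, on every HVT). It is normalised if $\min_i c_i=0$. The canonical offset vector is the unique elementwise smallest valid one. The Jacobian sparsity pattern is $S_0(c,d)=\{(i,j): d_j-c_i=\sigma_{ij}\}$. A permuted square-block form consists of permutations $\rho$ (of rows) and $\kappa$ (of columns) of $\{1,\ldots,n\}$ and positive integers $N_1,\ldots,N_p$ summing to $n$; put $B_l=\{i : \sum_{r<l}N_r < i\le \sum_{r\le l}N_r\}$, $R_l=\rho(B_l)$,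 $C_l=\kappa(B_l)$. It puts a pattern $A\subseteq\{1,\ldots,n\}^2$ into (upper) block-triangular form (BTF) if $A\cap(R_k\times C_l)=\emptyset$ whenever $k>l$. A pattern containing a transversal is irreducible if no such form with $p>1$ puts it into BTF. A BTF is irreducible if each diagonal sub-pattern $A\cap(R_l\times C_l)$ is irreducible (as an $N_l\times N_l$ pattern). The set of pairs $\{(R_1,C_1),\ldots,(R_p,C_p)\}$ is the same for every irreducible BTF of $A$ and is called the irreducible emblem of $A$. The fine (irreducible) blocks of $\Sigma$ are the pairs in the irreducible emblem of $S_{\mathrm{ess}}$ (which equals the irreducible emblem of every $S_0(c,d)$); enumerate them $(R_1,C_1),\ldots,(R_p,C_p)$ in some arbitrary order. An ordering of the fine blocks puts $S_0$ into BTF if $S_0\cap(R\times C')=\emptyset$ whenever fine block $(R,C)$ comes after fine block $(R',C')$ in that ordering. The canonical local offsets $(\widehat c_i)_{i\in R_l}$, $(\widehat d_j)_{j\in C_l}$ of fine block $l$ are the canonical offsets of the sub-matrix $(\sigma_{ij})_{i\in R_l,j\in C_l}$ regarded as a signature matrix in its own right. For each $l$ fix an anchor index $i_l\in R_l$ with $\widehat c_{i_l}=0$; then $\psi(c)=(c_{i_1},\ldots,c_{i_p})$. For $k,l\in\{1,\ldots,p\}$, $$W_{kl}=\max\{\sigma_{ij}-\widehat d_j+\widehat c_i : (i,j)\in S\cap(R_k\times C_l)\},$$ with $W_{kl}=-\infty$ if the set is empty. The vector $K=\psi(c)$ solves the block inequalities $K_l-K_k\ge W_{kl}$, $k,l\in\{1,\ldots,p\}$.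 The fine-block graph (FBG) of $\Sigma$ is the digraph with vertices $1,\ldots,p$ (the fine blocks) and an edge $k\to l$ of weight $W_{kl}$ for each pair $k\ne l$ with $S\cap(R_k\times C_l)\ne\emptyset$. An edge $k\to l$ is $K$-critical if $K_l-K_k=W_{kl}$; $\mathrm{FBG}(K)$ is the subgraph formed by the $K$-critical edges. It is acyclic. A linear order on the vertices of an acyclic digraph respects the graph order if $u$ comes before $v$ whenever there is an edge from $u$ to $v$. *)

theory Defs
  imports "HOL-Library.Extended_Real"
begin

text \<open>
  Rows and columns are indexed by finite sets \<open>R\<close>, \<open>C\<close> of natural numbers with
  \<open>card R = card C\<close>. An \<open>n \<times> n\<close> matrix has \<open>R = C = {1..n}\<close>; general \<open>R\<close>, \<open>C\<close> are
  needed for sub-matrices \<open>(\<sigma> i j)\<close>, \<open>i \<in> R\<close>, \<open>j \<in> C\<close>, treated as signature matrices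
  in their own right. Values of \<open>\<sigma>\<close>, \<open>c\<close>, \<open>d\<close> outside the index sets play no role.
\<close>

definition signature_matrix :: "nat set \<Rightarrow> nat set \<Rightarrow> (nat \<Rightarrow> nat \<Rightarrow> ereal) \<Rightarrow> bool" where
  "signature_matrix R C \<sigma> \<longleftrightarrow>
     finite R \<and> finite C \<and> card R = card C \<and>
     (\<forall>i\<in>R. \<forall>j\<in>C. \<sigma> i j = -\<infinity> \<or> (\<exists>m::nat. \<sigma> i j = ereal (real m)))"

definition transversal :: "nat set \<Rightarrow> nat set \<Rightarrow> (nat \<times> nat) set \<Rightarrow> bool" where
  "transversal R C T \<longleftrightarrow>
     T \<subseteq> R \<times> C \<and> (\<forall>i\<in>R. \<exists>!j. (i, j) \<in> T) \<and> (\<forall>j\<in>C. \<exists>!i. (i, j) \<in> T)"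

definition transversal_value :: "(nat \<Rightarrow> nat \<Rightarrow> ereal) \<Rightarrow> (nat \<times> nat) set \<Rightarrow> ereal" where
  "transversal_value \<sigma> T = (\<Sum>(i, j)\<in>T. \<sigma> i j)"

definition structurally_well_posed ::
  "nat set \<Rightarrow> nat set \<Rightarrow> (nat \<Rightarrow> nat \<Rightarrow> ereal) \<Rightarrow> bool" where
  "structurally_well_posed R C \<sigma> \<longleftrightarrow>
     (\<exists>T. transversal R C T \<and> (\<forall>(i, j)\<in>T. \<sigma> i j \<noteq> -\<infinity>))"

definition HVT ::
  "nat set \<Rightarrow> nat set \<Rightarrow> (nat \<Rightarrow> nat \<Rightarrow> ereal) \<Rightarrow> (nat \<times> nat) set \<Rightarrow> bool" where
  "HVT R C \<sigma> T \<longleftrightarrow>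
     transversal R C T \<and>
     (\<forall>T'. transversal R C T' \<longrightarrow> transversal_value \<sigma> T' \<le> transversal_value \<sigma> T)"

definition essential_pattern ::
  "nat set \<Rightarrow> nat set \<Rightarrow> (nat \<Rightarrow> nat \<Rightarrow> ereal) \<Rightarrow> (nat \<times> nat) set" where
  "essential_pattern R C \<sigma> = \<Union>{T. HVT R C \<sigma> T}"

definition sparsity_pattern ::
  "nat set \<Rightarrow> nat set \<Rightarrow> (nat \<Rightarrow> nat \<Rightarrow> ereal) \<Rightarrow> (nat \<times> nat) set" where
  "sparsity_pattern R C \<sigma> = {(i, j) \<in> R \<times> C. \<sigma> i j > -\<infinity>}"

definition valid_offsets ::
  "nat set \<Rightarrow> nat set \<Rightarrow> (nat \<Rightarrow> nat \<Rightarrow> ereal) \<Rightarrow> (nat \<Rightarrow> int) \<Rightarrow> (nat \<Rightarrow> int) \<Rightarrow> bool" where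
  "valid_offsets R C \<sigma> c d \<longleftrightarrow>
     (\<forall>i\<in>R. c i \<ge> 0) \<and>
     (\<forall>i\<in>R. \<forall>j\<in>C. ereal (of_int (d j - c i)) \<ge> \<sigma> i j) \<and>
     (\<exists>T. HVT R C \<sigma> T \<and> (\<forall>(i, j)\<in>T. ereal (of_int (d j - c i)) = \<sigma> i j))"

definition normalised_offsets ::
  "nat set \<Rightarrow> nat set \<Rightarrow> (nat \<Rightarrow> nat \<Rightarrow> ereal) \<Rightarrow> (nat \<Rightarrow> int) \<Rightarrow> (nat \<Rightarrow> int) \<Rightarrow> bool" where
  "normalised_offsets R C \<sigma> c d \<longleftrightarrow> valid_offsets R C \<sigma> c d \<and> Min (c ` R) = 0"

definition canonical_offsets ::
  "nat set \<Rightarrow> nat set \<Rightarrow> (nat \<Rightarrow> nat \<Rightarrow> ereal) \<Rightarrow> (nat \<Rightarrow> int) \<Rightarrow> (nat \<Rightarrow> int) \<Rightarrow> bool" where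
  "canonical_offsets R C \<sigma> c d \<longleftrightarrow>
     valid_offsets R C \<sigma> c d \<and>
     (\<forall>c' d'. valid_offsets R C \<sigma> c' d' \<longrightarrow>
        (\<forall>i\<in>R. c i \<le> c' i) \<and> (\<forall>j\<in>C. d j \<le> d' j))"

definition Jacobian_pattern ::
  "nat set \<Rightarrow> nat set \<Rightarrow> (nat \<Rightarrow> nat \<Rightarrow> ereal) \<Rightarrow> (nat \<Rightarrow> int) \<Rightarrow> (nat \<Rightarrow> int) \<Rightarrow> (nat \<times> nat) set" where
  "Jacobian_pattern R C \<sigma> c d = {(i, j) \<in> R \<times> C. ereal (of_int (d j - c i)) = \<sigma> i j}"

text \<open>The index block \<open>B\<^sub>l\<close> of positions cut out by block sizes \<open>N 1, N 2, \<dots>\<close>.\<close>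

definition index_block :: "(nat \<Rightarrow> nat) \<Rightarrow> nat \<Rightarrow> nat set" where
  "index_block N l = {i. (\<Sum>r\<in>{1..<l}. N r) < i \<and> i \<le> (\<Sum>r\<in>{1..l}. N r)}"

text \<open>For \<open>R = C = {1..n}\<close> the maps \<open>\<rho>\<close>, \<open>\<kappa>\<close> below are permutations of \<open>{1..n}\<close>; in general
  they also number the rows and columns of the sub-matrix.\<close>

definition square_block_form ::
  "nat set \<Rightarrow> nat set \<Rightarrow> nat \<Rightarrow> (nat \<Rightarrow> nat) \<Rightarrow> (nat \<Rightarrow> nat) \<Rightarrow> (nat \<Rightarrow> nat) \<Rightarrow> bool" where
  "square_block_form R C p N \<rho> \<kappa> \<longleftrightarrow>
     bij_betw \<rho> {1..card R} R \<and> bij_betw \<kappa> {1..card R} C \<and>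
     (\<forall>l\<in>{1..p}. N l > 0) \<and> (\<Sum>l\<in>{1..p}. N l) = card R"

definition puts_into_BTF ::
  "nat \<Rightarrow> (nat \<Rightarrow> nat) \<Rightarrow> (nat \<Rightarrow> nat) \<Rightarrow> (nat \<Rightarrow> nat) \<Rightarrow> (nat \<times> nat) set \<Rightarrow> bool" where
  "puts_into_BTF p N \<rho> \<kappa> A \<longleftrightarrow>
     (\<forall>k\<in>{1..p}. \<forall>l\<in>{1..p}. k > l \<longrightarrow>
        A \<inter> ((\<rho> ` index_block N k) \<times> (\<kappa> ` index_block N l)) = {})"

definition irreducible_pattern :: "nat set \<Rightarrow> nat set \<Rightarrow> (nat \<times> nat) set \<Rightarrow> bool" where
  "irreducible_pattern R C A \<longleftrightarrow>
     (\<exists>T. transversal R C T \<and> T \<subseteq> A) \<and>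
     \<not> (\<exists>p N \<rho> \<kappa>. p > 1 \<and> square_block_form R C p N \<rho> \<kappa> \<and> puts_into_BTF p N \<rho> \<kappa> A)"

definition irreducible_BTF ::
  "nat set \<Rightarrow> nat set \<Rightarrow> (nat \<times> nat) set \<Rightarrow> nat \<Rightarrow> (nat \<Rightarrow> nat) \<Rightarrow> (nat \<Rightarrow> nat) \<Rightarrow> (nat \<Rightarrow> nat) \<Rightarrow> bool" where
  "irreducible_BTF R C A p N \<rho> \<kappa> \<longleftrightarrow>
     square_block_form R C p N \<rho> \<kappa> \<and> puts_into_BTF p N \<rho> \<kappa> A \<and>
     (\<forall>l\<in>{1..p}.
        irreducible_pattern (\<rho> ` index_block N l) (\<kappa> ` index_block N l)
          (A \<inter> ((\<rho> ` index_block N l) \<times> (\<kappa> ` index_block N l))))"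

text \<open>Stated as a predicate on \<open>E\<close>: the emblem does not depend on the irreducible BTF chosen.\<close>

definition irreducible_emblem ::
  "nat set \<Rightarrow> nat set \<Rightarrow> (nat \<times> nat) set \<Rightarrow> (nat set \<times> nat set) set \<Rightarrow> bool" where
  "irreducible_emblem R C A E \<longleftrightarrow>
     (\<exists>p N \<rho> \<kappa>. irreducible_BTF R C A p N \<rho> \<kappa> \<and>
        E = (\<lambda>l. (\<rho> ` index_block N l, \<kappa> ` index_block N l)) ` {1..p})"

text \<open>\<open>(Rb 1, Cb 1), \<dots>, (Rb p, Cb p)\<close> enumerates the fine blocks, in an arbitrary order.\<close>

definition fine_block_enumeration ::
  "nat set \<Rightarrow> nat set \<Rightarrow> (nat \<Rightarrow> nat \<Rightarrow> ereal) \<Rightarrow> nat \<Rightarrow> (nat \<Rightarrow> nat set) \<Rightarrow> (nat \<Rightarrow> nat set) \<Rightarrow> bool" where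
  "fine_block_enumeration R C \<sigma> p Rb Cb \<longleftrightarrow>
     (\<exists>E. irreducible_emblem R C (essential_pattern R C \<sigma>) E \<and>
        bij_betw (\<lambda>l. (Rb l, Cb l)) {1..p} E)"

text \<open>A single pair \<open>ch\<close>, \<open>dh\<close> of functions holds the canonical local offsets of all fine blocks,
  which is possible because the fine blocks partition the rows and the columns.\<close>

definition canonical_local_offsets ::
  "(nat \<Rightarrow> nat \<Rightarrow> ereal) \<Rightarrow> nat \<Rightarrow> (nat \<Rightarrow> nat set) \<Rightarrow> (nat \<Rightarrow> nat set) \<Rightarrow>
   (nat \<Rightarrow> int) \<Rightarrow> (nat \<Rightarrow> int) \<Rightarrow> bool" where
  "canonical_local_offsets \<sigma> p Rb Cb ch dh \<longleftrightarrow>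
     (\<forall>l\<in>{1..p}. canonical_offsets (Rb l) (Cb l) \<sigma> ch dh)"

definition anchors ::
  "nat \<Rightarrow> (nat \<Rightarrow> nat set) \<Rightarrow> (nat \<Rightarrow> int) \<Rightarrow> (nat \<Rightarrow> nat) \<Rightarrow> bool" where
  "anchors p Rb ch a \<longleftrightarrow> (\<forall>l\<in>{1..p}. a l \<in> Rb l \<and> ch (a l) = 0)"

definition lead_times :: "(nat \<Rightarrow> nat) \<Rightarrow> (nat \<Rightarrow> int) \<Rightarrow> nat \<Rightarrow> int" where
  "lead_times a c l = c (a l)"

text \<open>In \<open>block_weight\<close>, \<open>fbg_edges\<close> and \<open>critical_edges\<close>, \<open>S\<close> is the sparsity pattern of \<open>\<sigma>\<close>.\<close>

definition block_weight ::
  "(nat \<times> nat) set \<Rightarrow> (nat \<Rightarrow> nat \<Rightarrow> ereal) \<Rightarrow> (nat \<Rightarrow> nat set) \<Rightarrow> (nat \<Rightarrow> nat set) \<Rightarrow>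
   (nat \<Rightarrow> int) \<Rightarrow> (nat \<Rightarrow> int) \<Rightarrow> nat \<Rightarrow> nat \<Rightarrow> ereal" where
  "block_weight S \<sigma> Rb Cb ch dh k l =
     (if S \<inter> (Rb k \<times> Cb l) = {} then -\<infinity>
      else Max ((\<lambda>(i, j). \<sigma> i j - ereal (of_int (dh j)) + ereal (of_int (ch i)))
                  ` (S \<inter> (Rb k \<times> Cb l))))"

text \<open>The vertex set of the fine-block graph is \<open>{1..p}\<close>; digraphs are given by their edge sets.\<close>

definition fbg_edges ::
  "(nat \<times> nat) set \<Rightarrow> nat \<Rightarrow> (nat \<Rightarrow> nat set) \<Rightarrow> (nat \<Rightarrow> nat set) \<Rightarrow> (nat \<times> nat) set" where
  "fbg_edges S p Rb Cb =
     {(k, l) \<in> {1..p} \<times> {1..p}. k \<noteq> l \<and> S \<inter> (Rb k \<times> Cb l) \<noteq> {}}"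

definition critical_edges ::
  "(nat \<times> nat) set \<Rightarrow> (nat \<Rightarrow> nat \<Rightarrow> ereal) \<Rightarrow> nat \<Rightarrow> (nat \<Rightarrow> nat set) \<Rightarrow> (nat \<Rightarrow> nat set) \<Rightarrow>
   (nat \<Rightarrow> int) \<Rightarrow> (nat \<Rightarrow> int) \<Rightarrow> (nat \<Rightarrow> int) \<Rightarrow> (nat \<times> nat) set" where
  "critical_edges S \<sigma> p Rb Cb ch dh K =
     {(k, l) \<in> fbg_edges S p Rb Cb.
        ereal (of_int (K l - K k)) = block_weight S \<sigma> Rb Cb ch dh k l}"

text \<open>Orderings are (reflexive) linear orders \<open>r\<close> on \<open>{1..p}\<close>.\<close>

definition comes_before :: "nat rel \<Rightarrow> nat \<Rightarrow> nat \<Rightarrow> bool" where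
  "comes_before r u v \<longleftrightarrow> (u, v) \<in> r \<and> u \<noteq> v"

definition ordering_puts_into_BTF ::
  "nat \<Rightarrow> (nat \<Rightarrow> nat set) \<Rightarrow> (nat \<Rightarrow> nat set) \<Rightarrow> nat rel \<Rightarrow> (nat \<times> nat) set \<Rightarrow> bool" where
  "ordering_puts_into_BTF p Rb Cb r A \<longleftrightarrow>
     (\<forall>k\<in>{1..p}. \<forall>l\<in>{1..p}. comes_before r l k \<longrightarrow> A \<inter> (Rb k \<times> Cb l) = {})"

definition respects_graph_order :: "nat rel \<Rightarrow> (nat \<times> nat) set \<Rightarrow> bool" where
  "respects_graph_order r G \<longleftrightarrow> (\<forall>(u, v)\<in>G. comes_before r u v)"

end

theory Submission
  imports Defs
begin

text \<open>
  On a fine block \<open>l\<close> both \<open>(c, d)\<close> and the local offsets are tight on every essential position: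
  an HVT is carried by the diagonal blocks, and its restriction to a block is an HVT of that block
  by linear programming duality. Hence \<open>c i - ch i = d j - dh j\<close> at every essential position of
  the block, and irreducibility forces this common value to be constant on the block, equal to
  \<open>K l\<close>. So \<open>d j - c i = \<sigma> i j\<close> at a position of \<open>R\<^sub>k \<times> C\<^sub>l\<close> if and only if
  \<open>K l - K k = \<sigma> i j - dh j + ch i\<close>, and the left side dominates in general; thus \<open>S\<^sub>0\<close> meets
  \<open>R\<^sub>k \<times> C\<^sub>l\<close> if and only if \<open>k \<rightarrow> l\<close> is critical.
\<close>

section \<open>Linear programming duality for transversals and offsets\<close>

text \<open>One strict summand would push the whole sum strictly below its bound. This is the step
  behind complementary slackness: equal totals leave no slack at any position.\<close>

lemma ereal_sum_tight:
  fixes f :: "'a \<Rightarrow> ereal" and g :: "'a \<Rightarrow> real"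
  assumes "finite A" and le: "\<And>x. x \<in> A \<Longrightarrow> f x \<le> ereal (g x)"
    and ge: "ereal (sum g A) \<le> sum f A" and "x \<in> A"
  shows "f x = ereal (g x)"
proof (rule ccontr)
  assume "f x \<noteq> ereal (g x)"
  with le[OF \<open>x \<in> A\<close>] have less: "f x < ereal (g x)" by simp
  have "sum f A = f x + sum f (A - {x})"
    using assms(1) \<open>x \<in> A\<close> by (rule sum.remove)
  also have "\<dots> \<le> f x + (\<Sum>y\<in>A - {x}. ereal (g y))"
    by (intro add_left_mono sum_mono le) auto
  also have "\<dots> = f x + ereal (sum g (A - {x}))" by simp
  \<comment> \<open>Strictness survives the addition because the added term is finite;
    \<open>f x\<close> itself may be \<open>-\<infinity>\<close>.\<close>
  also have "\<dots> < ereal (g x) + ereal (sum g (A - {x}))"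
    using less by (cases "f x") auto
  also have "\<dots> = ereal (sum g A)"
    using sum.remove[OF assms(1) \<open>x \<in> A\<close>, of g] by simp
  finally show False using ge by simp
qed

lemma transversal_bij_fst:
  assumes "transversal R C T"
  shows "bij_betw fst T R"
proof -
  have T: "T \<subseteq> R \<times> C" and ex: "\<And>i. i \<in> R \<Longrightarrow> \<exists>!j. (i, j) \<in> T"
    using assms by (auto simp: transversal_def)
  have "inj_on fst T"
  proof (rule inj_onI)
    fix s t assume "s \<in> T" "t \<in> T" "fst s = fst t"
    moreover from this have "\<exists>!j. (fst t, j) \<in> T" using T by (intro ex) auto
    ultimately show "s = t" by (metis prod.collapse)
  qed
  moreover have "fst ` T = R" using T ex by force
  ultimately show ?thesis by (simp add: bij_betw_def)
qed

lemma transversal_converse: "transversal R C T \<Longrightarrow> transversal C R (T\<inverse>)"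
  by (auto simp: transversal_def)

lemma transversal_bij_snd:
  assumes "transversal R C T"
  shows "bij_betw snd T C"
proof -
  have "bij_betw prod.swap T (T\<inverse>)"
    by (rule bij_betw_byWitness[of _ prod.swap]) auto
  moreover have "bij_betw fst (T\<inverse>) C"
    using assms by (intro transversal_bij_fst transversal_converse)
  ultimately have "bij_betw (fst \<circ> prod.swap) T C" by (rule bij_betw_trans)
  then show ?thesis by (simp add: comp_def)
qed

text \<open>A transversal meets each row and each column exactly once. The right side, the dual
  objective, is therefore common to all transversals.\<close>

lemma transversal_sum_offsets:
  fixes c d :: "nat \<Rightarrow> int"
  assumes "transversal R C T"
  shows "(\<Sum>(i, j)\<in>T. of_int (d j - c i) :: real) = (\<Sum>j\<in>C. of_int (d j)) - (\<Sum>i\<in>R. of_int (c i))"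
proof -
  have "(\<Sum>j\<in>C. of_int (d j) :: real) = (\<Sum>t\<in>T. of_int (d (snd t)))"
    using sum.reindex_bij_betw[OF transversal_bij_snd[OF assms], of "\<lambda>j. of_int (d j) :: real"] by simp
  moreover have "(\<Sum>i\<in>R. of_int (c i) :: real) = (\<Sum>t\<in>T. of_int (c (fst t)))"
    using sum.reindex_bij_betw[OF transversal_bij_fst[OF assms], of "\<lambda>i. of_int (c i) :: real"] by simp
  ultimately show ?thesis by (simp add: case_prod_unfold sum_subtractf)
qed

lemma transversal_value_tight:
  assumes T: "transversal R C T" and tight: "\<forall>(i, j)\<in>T. ereal (of_int (d j - c i)) = \<sigma> i j"
  shows "transversal_value \<sigma> T = ereal ((\<Sum>j\<in>C. of_int (d j)) - (\<Sum>i\<in>R. of_int (c i)))"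
proof -
  have "transversal_value \<sigma> T = (\<Sum>t\<in>T. ereal (case t of (i, j) \<Rightarrow> of_int (d j - c i)))"
    unfolding transversal_value_def using tight by (intro sum.cong) auto
  then show ?thesis using transversal_sum_offsets[OF T, of d c] by simp
qed

text \<open>Weak duality: dominance bounds the value of every transversal by the dual objective, and
  a tight transversal attains that bound.\<close>

lemma tight_transversal_HVT:
  assumes dom: "\<forall>i\<in>R. \<forall>j\<in>C. \<sigma> i j \<le> ereal (of_int (d j - c i))"
    and T: "transversal R C T" and tight: "\<forall>(i, j)\<in>T. ereal (of_int (d j - c i)) = \<sigma> i j"
  shows "HVT R C \<sigma> T"
  unfolding HVT_def
proof (intro conjI allI impI)
  fix T' assume T': "transversal R C T'"
  have "transversal_value \<sigma> T' \<le> (\<Sum>t\<in>T'. ereal (case t of (i, j) \<Rightarrow> of_int (d j - c i)))"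
    unfolding transversal_value_def using dom T' by (intro sum_mono) (auto simp: transversal_def)
  also have "\<dots> = transversal_value \<sigma> T"
    using transversal_sum_offsets[OF T', of d c] transversal_value_tight[OF T tight] by simp
  finally show "transversal_value \<sigma> T' \<le> transversal_value \<sigma> T" .
qed (rule T)

text \<open>Complementary slackness. Validity gives tightness on a single HVT \<open>T0\<close>,
  whose value is thus the dual objective; any other HVT reaches the same value and so has no slack
  either.\<close>

lemma valid_offsets_tight_HVT:
  assumes fin: "finite R" and valid: "valid_offsets R C \<sigma> c d"
    and T: "HVT R C \<sigma> T" and ij: "(i, j) \<in> T"
  shows "ereal (of_int (d j - c i)) = \<sigma> i j"
proof -
  have trT: "transversal R C T" using T by (simp add: HVT_def)
  obtain T0 where T0: "HVT R C \<sigma> T0" "\<forall>(i, j)\<in>T0. ereal (of_int (d j - c i)) = \<sigma> i j"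
    using valid by (auto simp: valid_offsets_def)
  have trT0: "transversal R C T0" using T0(1) by (simp add: HVT_def)
  have "transversal_value \<sigma> T0 \<le> transversal_value \<sigma> T"
    using T T0(1) by (simp add: HVT_def)
  then have ge: "ereal (\<Sum>(i, j)\<in>T. of_int (d j - c i)) \<le> (\<Sum>(i, j)\<in>T. \<sigma> i j)"
    using transversal_value_tight[OF trT0 T0(2)] transversal_sum_offsets[OF trT, of d c]
    by (simp add: transversal_value_def)
  have "finite T"
    using fin transversal_bij_fst[OF trT] by (simp add: bij_betw_finite)
  from ereal_sum_tight[OF this _ ge ij] valid trT show ?thesis
    by (fastforce simp: valid_offsets_def transversal_def)
qed

section \<open>Transversals inside block-triangular forms\<close>

text \<open>Writing a block as a difference of initial segments reduces claims about single blocks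
  to claims about leading groups of blocks.\<close>

lemma index_block_eq:
  assumes "l \<ge> 1"
  shows "index_block N l = {1..sum N {1..l}} - {1..sum N {1..l - 1}}"
proof -
  have "{1..<l} = {1..l - 1}" using assms by auto
  then show ?thesis by (auto simp: index_block_def)
qed

lemma index_block_cover:
  assumes "i \<in> {1..sum N {1..p}}"
  obtains l where "l \<in> {1..p}" "i \<in> index_block N l"
proof -
  define l where "l = (LEAST m. i \<le> sum N {1..m})"
  have il: "i \<le> sum N {1..l}" unfolding l_def using assms by (intro LeastI) auto
  then have l1: "l \<ge> 1" using assms by (cases l) auto
  have "\<not> i \<le> sum N {1..l - 1}"
    using l1 not_less_Least[of "l - 1" "\<lambda>m. i \<le> sum N {1..m}"] unfolding l_def by simp
  moreover have "l \<le> p" unfolding l_def using assms by (intro Least_le) auto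
  ultimately show thesis using that[of l] il l1 assms index_block_eq[OF l1] by auto
qed

lemma partial_sum_mono:
  fixes N :: "nat \<Rightarrow> nat"
  shows "k \<le> l \<Longrightarrow> sum N {1..k} \<le> sum N {1..l}"
  by (intro sum_mono2) auto

lemma bij_betw_preimage:
  assumes f: "bij_betw f A B" and "X \<subseteq> B"
  shows "bij_betw f {a \<in> A. f a \<in> X} X"
proof (rule bij_betw_subset[OF f])
  have "f ` A = B" using f by (simp add: bij_betw_def)
  then show "f ` {a \<in> A. f a \<in> X} = X" using \<open>X \<subseteq> B\<close> by blast
qed auto

text \<open>A pattern in BTF is empty below its first \<open>m\<close> column blocks, so the entries
  of \<open>T\<close> in those columns lie in the first \<open>m\<close> row blocks. There are as
  many such rows as columns, so counting gives the converse.\<close>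

lemma BTF_transversal_leading:
  assumes form: "square_block_form R C p N \<rho> \<kappa>" and btf: "puts_into_BTF p N \<rho> \<kappa> A"
    and T: "transversal R C T" "T \<subseteq> A" and m: "m \<le> p"
    and ij: "(i, j) \<in> T"
  shows "i \<in> \<rho> ` {1..sum N {1..m}} \<longleftrightarrow> j \<in> \<kappa> ` {1..sum N {1..m}}"
proof -
  let ?M = "{1..sum N {1..m}}"
  let ?TC = "{t \<in> T. snd t \<in> \<kappa> ` ?M}"
  let ?TR = "{t \<in> T. fst t \<in> \<rho> ` ?M}"
  have total: "sum N {1..p} = card R" and b\<rho>: "bij_betw \<rho> {1..card R} R"
    and b\<kappa>: "bij_betw \<kappa> {1..card R} C"
    using form by (auto simp: square_block_form_def)
  have Mle: "?M \<subseteq> {1..card R}" using partial_sum_mono[OF m, of N] total by auto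
  have sub: "?TC \<subseteq> ?TR"
  proof
    fix t assume t: "t \<in> ?TC"
    then obtain b where b: "b \<in> ?M" "snd t = \<kappa> b" by auto
    from b(1) obtain l where l: "l \<in> {1..m}" "b \<in> index_block N l"
      by (rule index_block_cover)
    have "fst t \<in> R" using t T by (auto simp: transversal_def)
    then have "fst t \<in> \<rho> ` {1..sum N {1..p}}"
      unfolding total using b\<rho> by (simp add: bij_betw_def)
    then obtain a where a: "a \<in> {1..sum N {1..p}}" "fst t = \<rho> a" by blast
    from a(1) obtain k where k: "k \<in> {1..p}" "a \<in> index_block N k"
      by (rule index_block_cover)
    \<comment> \<open>Otherwise \<open>t\<close> would be a position of \<open>A\<close> strictly
      below the diagonal blocks.\<close>
    have "\<not> k > l"
    proof
      assume "k > l"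
      then have "A \<inter> (\<rho> ` index_block N k \<times> \<kappa> ` index_block N l) = {}"
        using btf k l m by (auto simp: puts_into_BTF_def)
      moreover have "t \<in> A \<inter> (\<rho> ` index_block N k \<times> \<kappa> ` index_block N l)"
        using t T a b k l by (cases t) auto
      ultimately show False by blast
    qed
    then have "sum N {1..k} \<le> sum N {1..m}"
      using l by (intro partial_sum_mono) auto
    then have "a \<in> ?M" using k index_block_eq[of k N] by auto
    then show "t \<in> ?TR" using t a by auto
  qed
  have bf: "bij_betw fst T R" and bs: "bij_betw snd T C"
    using T transversal_bij_fst transversal_bij_snd by auto
  have rR: "\<rho> ` ?M \<subseteq> R" and kC: "\<kappa> ` ?M \<subseteq> C"
    using Mle b\<rho> b\<kappa> by (auto simp: bij_betw_def)
  have TR: "bij_betw fst ?TR (\<rho> ` ?M)" using bf rR by (rule bij_betw_preimage)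
  have TC: "bij_betw snd ?TC (\<kappa> ` ?M)" using bs kC by (rule bij_betw_preimage)
  have "inj_on \<rho> ?M" "inj_on \<kappa> ?M"
    using b\<rho> b\<kappa> Mle inj_on_subset unfolding bij_betw_def by blast+
  then have "card (\<rho> ` ?M) = card (\<kappa> ` ?M)" by (simp add: card_image)
  \<comment> \<open>Both sets have \<open>sum N {1..m}\<close> elements, which turns the inclusion
    \<open>sub\<close> into an equality.\<close>
  then have "card ?TC = card ?TR"
    using bij_betw_same_card[OF TR] bij_betw_same_card[OF TC] by simp
  moreover have "finite ?TR" using bij_betw_finite[OF TR] by simp
  ultimately have "?TC = ?TR" using sub by (intro card_subset_eq)
  then have "(i, j) \<in> ?TR \<longleftrightarrow> (i, j) \<in> ?TC" by (simp only:)
  then show ?thesis using ij unfolding mem_Collect_eq fst_conv snd_conv by blast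
qed

text \<open>Block \<open>l\<close> consists of the first \<open>l\<close> blocks without the first
  \<open>l - 1\<close>, and the leading case applies to both groups.\<close>

lemma BTF_transversal_diagonal:
  assumes form: "square_block_form R C p N \<rho> \<kappa>" and btf: "puts_into_BTF p N \<rho> \<kappa> A"
    and T: "transversal R C T" "T \<subseteq> A" and l: "l \<in> {1..p}"
    and ij: "(i, j) \<in> T"
  shows "i \<in> \<rho> ` index_block N l \<longleftrightarrow> j \<in> \<kappa> ` index_block N l"
proof -
  have total: "sum N {1..p} = card R" and "inj_on \<rho> {1..card R}" "inj_on \<kappa> {1..card R}"
    using form by (auto simp: square_block_form_def bij_betw_def)
  moreover have "sum N {1..l} \<le> sum N {1..p}"
    using l by (intro partial_sum_mono) simp
  moreover have "sum N {1..l - 1} \<le> sum N {1..p}"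
    using l by (intro partial_sum_mono) auto
  ultimately have inj: "inj_on \<rho> {1..card R}" "inj_on \<kappa> {1..card R}"
    and sub: "{1..sum N {1..l}} \<subseteq> {1..card R}" "{1..sum N {1..l - 1}} \<subseteq> {1..card R}"
    by auto
  \<comment> \<open>Injectivity is what lets the image commute with the set difference.\<close>
  have img: "f ` index_block N l = f ` {1..sum N {1..l}} - f ` {1..sum N {1..l - 1}}"
    if "inj_on f {1..card R}" for f :: "nat \<Rightarrow> nat"
  proof -
    have "index_block N l = {1..sum N {1..l}} - {1..sum N {1..l - 1}}"
      using l by (intro index_block_eq) simp
    then show ?thesis using inj_on_image_set_diff[OF that _ sub(2)] sub(1) by blast
  qed
  have "l \<le> p" "l - 1 \<le> p" using l by auto
  then have "i \<in> \<rho> ` {1..sum N {1..l}} \<longleftrightarrow> j \<in> \<kappa> ` {1..sum N {1..l}}"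
    "i \<in> \<rho> ` {1..sum N {1..l - 1}} \<longleftrightarrow> j \<in> \<kappa> ` {1..sum N {1..l - 1}}"
    using BTF_transversal_leading[OF form btf T _ ij] by blast+
  then show ?thesis unfolding img[OF inj(1)] img[OF inj(2)] Diff_iff by blast
qed

lemma transversal_restrict:
  assumes T: "transversal R C T" and "R' \<subseteq> R" "C' \<subseteq> C"
    and "\<And>i j. (i, j) \<in> T \<Longrightarrow> i \<in> R' \<longleftrightarrow> j \<in> C'"
  shows "transversal R' C' (T \<inter> R' \<times> C')"
  using assms unfolding transversal_def by (auto; blast)

section \<open>Functions on an irreducible pattern\<close>

text \<open>Supplies the row or column permutation of a two-block form whose first block is a
  prescribed subset.\<close>

lemma ex_numbering_initial:
  assumes "finite R" "R1 \<subseteq> R"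
  obtains \<rho> where "bij_betw \<rho> {1..card R} R" "\<rho> ` {1..card R1} = R1"
    "\<rho> ` {card R1<..card R} = R - R1"
proof -
  have fin: "finite R1" "finite (R - R1)" using assms finite_subset by auto
  have le: "card R1 \<le> card R" using assms by (intro card_mono)
  have "card {card R1<..card R} = card (R - R1)"
    using assms fin by (simp add: card_Diff_subset)
  then obtain g where g: "bij_betw g {card R1<..card R} (R - R1)"
    using fin by (metis finite_greaterThanAtMost finite_same_card_bij)
  obtain f where f: "bij_betw f {1..card R1} R1"
    using fin by (metis ex_bij_betw_nat_finite_1)
  define \<rho> where "\<rho> = (\<lambda>i. if i \<in> {1..card R1} then f i else g i)"
  have a: "bij_betw \<rho> {1..card R1} R1"
    using f by (rule bij_betw_cong[THEN iffD1, rotated]) (simp add: \<rho>_def)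
  have b: "bij_betw \<rho> {card R1<..card R} (R - R1)"
    using g by (rule bij_betw_cong[THEN iffD1, rotated]) (auto simp: \<rho>_def)
  have "bij_betw \<rho> ({1..card R1} \<union> {card R1<..card R}) (R1 \<union> (R - R1))"
    using a b by (rule bij_betw_combine) auto
  moreover have "{1..card R1} \<union> {card R1<..card R} = {1..card R}" "R1 \<union> (R - R1) = R"
    using le assms by auto
  ultimately show thesis using that[of \<rho>] a b by (simp add: bij_betw_def)
qed

text \<open>The level sets \<open>R1\<close> and \<open>C1\<close> of the value \<open>x i0\<close>
  are matched with each other by a transversal, so they have equal size, and \<open>A\<close> never
  joins a row outside \<open>R1\<close> to a column of \<open>C1\<close>. A proper \<open>R1\<close>
  would therefore give a BTF with two blocks.\<close>

lemma irreducible_pattern_constant: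
  assumes fin: "finite R" and irr: "irreducible_pattern R C A"
    and eq: "\<And>i j. (i, j) \<in> A \<Longrightarrow> i \<in> R \<Longrightarrow> j \<in> C \<Longrightarrow> x i = y j"
    and i0: "i0 \<in> R"
  shows "\<forall>i\<in>R. x i = x i0" and "\<forall>j\<in>C. y j = x i0"
proof -
  obtain T where T: "transversal R C T" "T \<subseteq> A" using irr by (auto simp: irreducible_pattern_def)
  have bf: "bij_betw fst T R" and bs: "bij_betw snd T C"
    using T transversal_bij_fst transversal_bij_snd by auto
  have eqT: "x (fst t) = y (snd t)" if "t \<in> T" for t
    using that T by (intro eq) (auto simp: transversal_def)
  define R1 where "R1 = {i \<in> R. x i = x i0}"
  define C1 where "C1 = {j \<in> C. y j = x i0}"
  have cards: "card R = card C"
    using bij_betw_same_card[OF bf] bij_betw_same_card[OF bs] by simp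
  have sub: "R1 \<subseteq> R" "C1 \<subseteq> C" by (auto simp: R1_def C1_def)
  have "fst t \<in> R1 \<longleftrightarrow> snd t \<in> C1" if "t \<in> T" for t
    using eqT[OF that] that T(1) by (auto simp: R1_def C1_def transversal_def)
  then have "{t \<in> T. fst t \<in> R1} = {t \<in> T. snd t \<in> C1}" by blast
  then have cards1: "card R1 = card C1"
    using bij_betw_same_card[OF bij_betw_preimage[OF bf sub(1)]]
      bij_betw_same_card[OF bij_betw_preimage[OF bs sub(2)]] by simp
  have finC: "finite C" using fin bij_betw_finite[OF bf] bij_betw_finite[OF bs] by simp
  have "R1 = R"
  proof (rule ccontr)
    assume "R1 \<noteq> R"
    then have lt: "card R1 < card R" using sub fin by (intro psubset_card_mono) auto
    \<comment> \<open>Block sizes must be positive: \<open>i0\<close> keeps the first block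
      nonempty, \<open>lt\<close> the second.\<close>
    have "i0 \<in> R1" using i0 by (simp add: R1_def)
    then have pos: "card R1 > 0" using finite_subset[OF sub(1) fin] by (auto simp: card_gt_0_iff)
    obtain \<rho> where \<rho>: "bij_betw \<rho> {1..card R} R" "\<rho> ` {1..card R1} = R1"
      "\<rho> ` {card R1<..card R} = R - R1"
      using ex_numbering_initial[OF fin sub(1)] by blast
    obtain \<kappa> where \<kappa>: "bij_betw \<kappa> {1..card C} C" "\<kappa> ` {1..card C1} = C1"
      "\<kappa> ` {card C1<..card C} = C - C1"
      using ex_numbering_initial[OF finC sub(2)] by blast
    define N where "N = (\<lambda>l::nat. if l = 1 then card R1 else card R - card R1)"
    have I2: "{1..2} = {1, 2 :: nat}" by auto
    have IB: "index_block N 1 = {1..card R1}" "index_block N 2 = {card R1<..card R}"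
      using lt by (auto simp: index_block_def N_def I2 numeral_2_eq_2)
    have "square_block_form R C 2 N \<rho> \<kappa>"
      unfolding square_block_form_def I2 using \<rho>(1) \<kappa>(1) cards lt pos by (simp add: N_def)
    moreover have "puts_into_BTF 2 N \<rho> \<kappa> A"
    proof -
      have "\<rho> ` index_block N 2 = R - R1" "\<kappa> ` index_block N 1 = C1"
        unfolding IB using \<rho>(3) \<kappa>(2) cards1 by simp_all
      \<comment> \<open>Only the lower left block needs checking: a position there would have
        \<open>x i \<noteq> x i0\<close> but \<open>y j = x i0\<close>, against
        \<open>eq\<close>.\<close>
      moreover have "A \<inter> ((R - R1) \<times> C1) = {}" using eq by (fastforce simp: R1_def C1_def)
      ultimately show ?thesis unfolding puts_into_BTF_def I2 by simp
    qed
    moreover have "(1::nat) < 2" by simp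
    ultimately show False using irr unfolding irreducible_pattern_def by blast
  qed
  then show x: "\<forall>i\<in>R. x i = x i0" by (auto simp: R1_def)
  have "card C1 = card C" using cards cards1 \<open>R1 = R\<close> by simp
  then have "C1 = C" using finC sub by (metis card_subset_eq)
  then show "\<forall>j\<in>C. y j = x i0" by (auto simp: C1_def)
qed

section \<open>Global and local offsets on a fine block\<close>

text \<open>In the application \<open>i0\<close> is the anchor, where \<open>ch i0 = 0\<close>, so
  the common shift becomes the lead time of the block.\<close>

lemma fine_block_offsets_shift:
  assumes fin: "finite R" and valid: "valid_offsets R C \<sigma> c d"
    and btf: "irreducible_BTF R C (essential_pattern R C \<sigma>) p N \<rho> \<kappa>"
    and l: "l \<in> {1..p}"
    and Rl: "Rl = \<rho> ` index_block N l" and Cl: "Cl = \<kappa> ` index_block N l"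
    and local: "valid_offsets Rl Cl \<sigma> ch dh" and i0: "i0 \<in> Rl"
  shows "Rl \<subseteq> R" and "Cl \<subseteq> C"
    and "\<forall>i\<in>Rl. c i - ch i = c i0 - ch i0" and "\<forall>j\<in>Cl. d j - dh j = c i0 - ch i0"
proof -
  let ?A = "essential_pattern R C \<sigma>"
  have form: "square_block_form R C p N \<rho> \<kappa>" and put: "puts_into_BTF p N \<rho> \<kappa> ?A"
    and irr: "irreducible_pattern Rl Cl (?A \<inter> Rl \<times> Cl)"
    using btf l by (auto simp: irreducible_BTF_def Rl Cl)
  have "sum N {1..l} \<le> card R"
    using partial_sum_mono[of l p N] l form by (auto simp: square_block_form_def)
  then have "index_block N l \<subseteq> {1..card R}" using l index_block_eq[of l N] by auto
  then show RR: "Rl \<subseteq> R" and CC: "Cl \<subseteq> C"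
    using form by (auto simp: Rl Cl square_block_form_def bij_betw_def)
  have finl: "finite Rl" using RR fin by (rule finite_subset)
  have tight: "c i - ch i = d j - dh j" if ij: "(i, j) \<in> ?A \<inter> Rl \<times> Cl" for i j
  proof -
    obtain T where T: "HVT R C \<sigma> T" "(i, j) \<in> T" using ij by (auto simp: essential_pattern_def)
    have tr: "transversal R C T" "T \<subseteq> ?A" using T by (auto simp: HVT_def essential_pattern_def)
    have trl: "transversal Rl Cl (T \<inter> Rl \<times> Cl)"
      using BTF_transversal_diagonal[OF form put tr l] RR CC tr(1)
      by (intro transversal_restrict) (auto simp: Rl Cl)
    \<comment> \<open>The global offsets, restricted to the block, serve as the dual certificate of
      optimality. The local offsets are then tight on this restriction by complementary
      slackness.\<close>
    have "HVT Rl Cl \<sigma> (T \<inter> Rl \<times> Cl)"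
    proof (rule tight_transversal_HVT[OF _ trl])
      show "\<forall>i\<in>Rl. \<forall>j\<in>Cl. \<sigma> i j \<le> ereal (of_int (d j - c i))"
        using valid RR CC unfolding valid_offsets_def by blast
      show "\<forall>(i, j)\<in>T \<inter> Rl \<times> Cl. ereal (of_int (d j - c i)) = \<sigma> i j"
        using valid_offsets_tight_HVT[OF fin valid T(1)] by auto
    qed
    then have "ereal (of_int (dh j - ch i)) = \<sigma> i j"
      using valid_offsets_tight_HVT[OF finl local] T(2) ij by blast
    moreover have "ereal (of_int (d j - c i)) = \<sigma> i j"
      using valid_offsets_tight_HVT[OF fin valid T] .
    ultimately have "ereal (of_int (dh j - ch i)) = ereal (of_int (d j - c i))" by simp
    then have "dh j - ch i = d j - c i" unfolding ereal.inject of_int_eq_iff .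
    then show ?thesis by simp
  qed
  \<comment> \<open>Irreducibility is applied to \<open>x i = c i - ch i\<close> and
    \<open>y j = d j - dh j\<close>, which agree at essential positions by
    \<open>tight\<close>.\<close>
  show "\<forall>i\<in>Rl. c i - ch i = c i0 - ch i0"
    by (rule irreducible_pattern_constant(1)[OF finl irr tight i0]) auto
  show "\<forall>j\<in>Cl. d j - dh j = c i0 - ch i0"
    by (rule irreducible_pattern_constant(2)[OF finl irr tight i0]) auto
qed

section \<open>Critical edges and orderings of the fine blocks\<close>

text \<open>An upper bound of a finite nonempty set equals its maximum exactly when it belongs to
  the set. Nonemptiness excludes the default weight \<open>-\<infinity>\<close>.\<close>

lemma block_weight_attained_iff:
  fixes K :: int
  assumes "finite S" "S \<inter> (Rb k \<times> Cb l) \<noteq> {}"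
    and le: "\<And>i j. (i, j) \<in> S \<inter> (Rb k \<times> Cb l) \<Longrightarrow>
       \<sigma> i j - ereal (of_int (dh j)) + ereal (of_int (ch i)) \<le> ereal (of_int K)"
  shows "ereal (of_int K) = block_weight S \<sigma> Rb Cb ch dh k l \<longleftrightarrow>
    (\<exists>(i, j) \<in> S \<inter> (Rb k \<times> Cb l).
       \<sigma> i j - ereal (of_int (dh j)) + ereal (of_int (ch i)) = ereal (of_int K))"
proof -
  let ?f = "\<lambda>(i, j). \<sigma> i j - ereal (of_int (dh j)) + ereal (of_int (ch i))"
  let ?X = "?f ` (S \<inter> (Rb k \<times> Cb l))"
  have finX: "finite ?X" using assms(1) by (intro finite_imageI finite_Int) simp
  have neX: "?X \<noteq> {}" using assms(2) unfolding image_is_empty .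
  have ub: "w \<le> ereal (of_int K)" if "w \<in> ?X" for w
  proof -
    from that obtain t where t: "w = ?f t" "t \<in> S \<inter> (Rb k \<times> Cb l)" by (rule imageE)
    show ?thesis
      using le[of "fst t" "snd t", unfolded prod.collapse, OF t(2)] t(1)
      by (simp add: case_prod_unfold)
  qed
  have W: "block_weight S \<sigma> Rb Cb ch dh k l = Max ?X"
    unfolding block_weight_def if_not_P[OF assms(2)] ..
  show ?thesis
    unfolding W
  proof
    assume "ereal (of_int K) = Max ?X"
    with Max_in[OF finX neX] have "ereal (of_int K) \<in> ?X" by simp
    then obtain t where t: "ereal (of_int K) = ?f t" "t \<in> S \<inter> (Rb k \<times> Cb l)"
      by (rule imageE)
    show "\<exists>(i, j) \<in> S \<inter> (Rb k \<times> Cb l).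
        \<sigma> i j - ereal (of_int (dh j)) + ereal (of_int (ch i)) = ereal (of_int K)"
      using t(1) by (intro bexI[OF _ t(2)]) (simp add: case_prod_unfold)
  next
    assume "\<exists>(i, j) \<in> S \<inter> (Rb k \<times> Cb l).
        \<sigma> i j - ereal (of_int (dh j)) + ereal (of_int (ch i)) = ereal (of_int K)"
    then obtain t where "t \<in> S \<inter> (Rb k \<times> Cb l)" "?f t = ereal (of_int K)"
      by (rule bexE) (simp add: case_prod_unfold)
    then have "ereal (of_int K) \<in> ?X" by (intro image_eqI[of _ ?f t]) simp_all
    from Max_eqI[OF finX ub this] show "ereal (of_int K) = Max ?X" by (rule sym)
  qed
qed

theorem theorem5p5:
  fixes n p :: nat
    and \<sigma> :: "nat \<Rightarrow> nat \<Rightarrow> ereal"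
    and c d ch dh K :: "nat \<Rightarrow> int"
    and Rb Cb :: "nat \<Rightarrow> nat set"
    and a :: "nat \<Rightarrow> nat"
    and S S\<^sub>0 :: "(nat \<times> nat) set"
    and r :: "nat rel"
  assumes "signature_matrix {1..n} {1..n} \<sigma>"
    and "structurally_well_posed {1..n} {1..n} \<sigma>"
    and "S = sparsity_pattern {1..n} {1..n} \<sigma>"
    and "fine_block_enumeration {1..n} {1..n} \<sigma> p Rb Cb"
    and "canonical_local_offsets \<sigma> p Rb Cb ch dh"
    and "anchors p Rb ch a"
    and "normalised_offsets {1..n} {1..n} \<sigma> c d"
    and "S\<^sub>0 = Jacobian_pattern {1..n} {1..n} \<sigma> c d"
    and "K = lead_times a c"
    and "linear_order_on {1..p} r"
  shows "ordering_puts_into_BTF p Rb Cb r S\<^sub>0 \<longleftrightarrow>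
         respects_graph_order r (critical_edges S \<sigma> p Rb Cb ch dh K)"
proof -
  have valid: "valid_offsets {1..n} {1..n} \<sigma> c d"
    using assms(7) by (simp add: normalised_offsets_def)
  obtain E q N \<rho> \<kappa> where btf: "irreducible_BTF {1..n} {1..n} (essential_pattern {1..n} {1..n} \<sigma>) q N \<rho> \<kappa>"
    and E: "E = (\<lambda>l. (\<rho> ` index_block N l, \<kappa> ` index_block N l)) ` {1..q}"
    and enum: "bij_betw (\<lambda>l. (Rb l, Cb l)) {1..p} E"
    using assms(4) unfolding fine_block_enumeration_def irreducible_emblem_def by auto
  have block: "Rb l \<subseteq> {1..n} \<and> Cb l \<subseteq> {1..n} \<and>
      (\<forall>i\<in>Rb l. c i - ch i = K l) \<and> (\<forall>j\<in>Cb l. d j - dh j = K l)" if l: "l \<in> {1..p}" for l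
  proof -
    have "(Rb l, Cb l) \<in> E" using enum l by (auto simp: bij_betw_def)
    then obtain m where m: "m \<in> {1..q}" "Rb l = \<rho> ` index_block N m" "Cb l = \<kappa> ` index_block N m"
      unfolding E by auto
    have local: "valid_offsets (Rb l) (Cb l) \<sigma> ch dh"
      using assms(5) l by (auto simp: canonical_local_offsets_def canonical_offsets_def)
    have a: "a l \<in> Rb l" "ch (a l) = 0" using assms(6) l by (auto simp: anchors_def)
    show ?thesis
      using fine_block_offsets_shift[OF _ valid btf m local a(1)] a(2)
      by (simp add: assms(9) lead_times_def)
  qed
  have crit: "(k, l) \<in> critical_edges S \<sigma> p Rb Cb ch dh K \<longleftrightarrow> S\<^sub>0 \<inter> (Rb k \<times> Cb l) \<noteq> {}"
    if k: "k \<in> {1..p}" and l: "l \<in> {1..p}" and "k \<noteq> l" for k l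
  proof -
    \<comment> \<open>A tight position carries an integer value, hence a finite one.\<close>
    have S0S: "S\<^sub>0 \<subseteq> S"
      by (auto simp: assms(3,8) Jacobian_pattern_def sparsity_pattern_def)
    have finS: "finite S"
      by (rule finite_subset[of _ "{1..n} \<times> {1..n}"]) (auto simp: assms(3) sparsity_pattern_def)
    have shift: "\<sigma> i j - ereal (of_int (dh j)) + ereal (of_int (ch i)) \<le> ereal (of_int (K l - K k)) \<and>
        (\<sigma> i j - ereal (of_int (dh j)) + ereal (of_int (ch i)) = ereal (of_int (K l - K k)) \<longleftrightarrow>
         (i, j) \<in> S\<^sub>0)"
      if ij: "(i, j) \<in> S \<inter> (Rb k \<times> Cb l)" for i j
    proof -
      have n: "i \<in> {1..n}" "j \<in> {1..n}" using ij block[OF k] block[OF l] by auto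
      have "\<sigma> i j \<noteq> -\<infinity>" using ij by (auto simp: assms(3) sparsity_pattern_def)
      moreover have "\<sigma> i j = -\<infinity> \<or> (\<exists>m::nat. \<sigma> i j = ereal (real m))"
        using assms(1) n unfolding signature_matrix_def by blast
      ultimately obtain m :: nat where m: "\<sigma> i j = ereal (real m)" by blast
      \<comment> \<open>The row \<open>i\<close> lies in block \<open>k\<close> and the column
        \<open>j\<close> in block \<open>l\<close>. Substituting both shifts cancels the local
        offsets and leaves the comparison of \<open>\<sigma> i j\<close> with
        \<open>d j - c i\<close>.\<close>
      have K: "K k = c i - ch i" "K l = d j - dh j" using ij block[OF k] block[OF l] by auto
      have "\<sigma> i j \<le> ereal (of_int (d j - c i))" using valid n by (auto simp: valid_offsets_def)
      then show ?thesis using n m K by (auto simp: assms(8) Jacobian_pattern_def)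
    qed
    have "ereal (of_int (K l - K k)) = block_weight S \<sigma> Rb Cb ch dh k l \<longleftrightarrow>
        S\<^sub>0 \<inter> (Rb k \<times> Cb l) \<noteq> {}" if "S \<inter> (Rb k \<times> Cb l) \<noteq> {}"
    proof -
      have "ereal (of_int (K l - K k)) = block_weight S \<sigma> Rb Cb ch dh k l \<longleftrightarrow>
        (\<exists>(i, j) \<in> S \<inter> (Rb k \<times> Cb l). \<sigma> i j - ereal (of_int (dh j)) + ereal (of_int (ch i)) =
           ereal (of_int (K l - K k)))"
        by (rule block_weight_attained_iff) (rule finS, rule that, rule conjunct1[OF shift])
      also have "\<dots> \<longleftrightarrow> (\<exists>(i, j) \<in> S \<inter> (Rb k \<times> Cb l). (i, j) \<in> S\<^sub>0)"
      proof (rule bex_cong[OF refl], unfold case_prod_unfold prod.collapse)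
        fix t assume t: "t \<in> S \<inter> (Rb k \<times> Cb l)"
        show "\<sigma> (fst t) (snd t) - ereal (of_int (dh (snd t))) + ereal (of_int (ch (fst t))) =
            ereal (of_int (K l - K k)) \<longleftrightarrow> t \<in> S\<^sub>0"
          by (rule conjunct2[OF shift[of "fst t" "snd t", unfolded prod.collapse, OF t]])
      qed
      also have "\<dots> \<longleftrightarrow> S\<^sub>0 \<inter> (Rb k \<times> Cb l) \<noteq> {}" using S0S by blast
      finally show ?thesis .
    qed
    \<comment> \<open>If \<open>S\<close> misses the block there is no edge, and by
      \<open>S0S\<close> no position of \<open>S\<^sub>0\<close> either.\<close>
    then show ?thesis
      using k l \<open>k \<noteq> l\<close> S0S by (auto simp: critical_edges_def fbg_edges_def)
  qed
  \<comment> \<open>Totality and antisymmetry: of two distinct blocks exactly one comes first.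
    Through \<open>crit\<close>, a forbidden order of a pair thus becomes a required one, which
    gives both directions.\<close>
  have tot: "comes_before r k l \<longleftrightarrow> \<not> comes_before r l k"
    if "k \<in> {1..p}" "l \<in> {1..p}" "k \<noteq> l" for k l
    using assms(10) that
    unfolding comes_before_def linear_order_on_def partial_order_on_def antisym_def total_on_def
    by blast
  have edges: "(k, l) \<in> critical_edges S \<sigma> p Rb Cb ch dh K \<Longrightarrow> k \<in> {1..p} \<and> l \<in> {1..p} \<and> k \<noteq> l" for k l
    by (auto simp: critical_edges_def fbg_edges_def)
  have irrefl: "\<not> comes_before r l l" for l by (simp add: comes_before_def)
  show ?thesis
  proof
    assume L: "ordering_puts_into_BTF p Rb Cb r S\<^sub>0"
    show "respects_graph_order r (critical_edges S \<sigma> p Rb Cb ch dh K)"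
      unfolding respects_graph_order_def
    proof clarify
      fix k l assume kl: "(k, l) \<in> critical_edges S \<sigma> p Rb Cb ch dh K"
      then have "\<not> comes_before r l k"
        using L edges[OF kl] crit[of k l] unfolding ordering_puts_into_BTF_def by blast
      then show "comes_before r k l" using tot edges[OF kl] by blast
    qed
  next
    assume G: "respects_graph_order r (critical_edges S \<sigma> p Rb Cb ch dh K)"
    show "ordering_puts_into_BTF p Rb Cb r S\<^sub>0"
      unfolding ordering_puts_into_BTF_def
    proof (intro ballI impI)
      fix k l assume kl: "k \<in> {1..p}" "l \<in> {1..p}" "comes_before r l k"
      then have "k \<noteq> l" using irrefl by blast
      then have "(k, l) \<notin> critical_edges S \<sigma> p Rb Cb ch dh K"
        using G tot kl unfolding respects_graph_order_def by blast
      then show "S\<^sub>0 \<inter> (Rb k \<times> Cb l) = {}" using crit kl \<open>k \<noteq> l\<close> by blast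
    qed
  qed
qed

end
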